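(* Let $P\in\mathbb{R}^{q\times n}$, $A\in\mathbb{R}^{m\times n}$, $b\in\mathbb{R}^m$, and let $S=\{x\in\mathbb{R}^n\mid Ax\ge b\}\neq\emptyset$. Let $f\colon\mathbb{R}^q\to\mathbb{R}\cup\{-\infty,+\infty\}$ be quasi-concave. Let $C=\{y\in\mathbb{R}^q\mid Z^{\top}y\ge 0\}=\{Y\lambda\mid\lambda\in\mathbb{R}^o_+\}$ be a polyhedral convex pointed cone with nonempty interior such that $f$ is $C$-monotone on $P[S]-C$ and $0^+P[S]\subseteq C$, and let $c\in\operatorname{int}C$ with $c_q=1$. Then the modified dual Benson-type algorithm described in the context (with input $A,b,P,Z,Y,c,f$ and a polyhedron $\mathcal{O}$ with $\mathcal{O}\supseteq P[S]+C$ and $0^+\mathcal{O}=C$) is correct and finite: for any admissible choices made during its execution, all its steps can be carried out, it terminates after finitely many iterations, and the point $x$ it returns is an optimal solution of $$\min f(Px)\quad\text{s.t.}\quad Ax\ge b.$$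
   Context: Notation: $P[S]=\{Px\mid x\in S\}$; sums and differences of sets are Minkowski sums and differences; $0^+D$ is the recession cone of a nonempty polyhedron $D$. A cone $C$ is pointed if $C\cap(-C)=\{0\}$. $f$ is quasi-concave if all sets $\{y\mid f(y)\ge r\}$, $r\in\mathbb{R}$, are convex. $x\le_C y$ means $y-x\in C$; $f$ is $C$-monotone on $D$ if $x,y\in D$, $x\le_C y$ imply $f(x)\le f(y)$. For $y,y^*\in\mathbb{R}^q$ put $$\varphi(y,y^* )=\sum_{i=1}^{q-1}y_iy_i^*+y_q\Bigl(1-\sum_{i=1}^{q-1}c_iy_i^*\Bigr)-y_q^*,\qquad \omega(y^* )=\Bigl(y_1^*,\dots,y_{q-1}^*,\,1-\sum_{i=1}^{q-1}c_iy_i^*\Bigr)^{\top}.$$ ($\omega(y^* )$ depends only on the first $q-1$ components of $y^*$.) For $w\in\mathbb{R}^q$ let $(\mathrm{P}_1(w))$ be the linear program $\min w^{\top}Px$ s.t. $Ax\ge b$. Algorithm. Initialization: $\mathcal{O}^*:=\{y^*\in\mathbb{R}^q\mid y^{\top}\omega(y^* )\ge 0\text{ for every column }y\text{ of }Y\}$; $T^*:=\emptyset$; $w:=$ sum of the columns of $Z$; $t^*:=(c^{\top}w)^{-1}w$, and then its last component is reset to $t^*_q:=+\infty$. Loop: (1) $w:=\omega(t^* )$; let $x$ be any optimal solution of $(\mathrm{P}_1(w))$. (2) If $t^*_q-w^{\top}Px>0$, replace $\mathcal{O}^*$ by $\mathcal{O}^*\cap\{y^*\in\mathbb{R}^q\mid\varphi(Px,y^*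 )\ge 0\}$ and recompute the set $\mathcal{O}^*_{\rm poi}$ of vertices of $\mathcal{O}^*$; otherwise replace $T^*$ by $T^*\cup\{t^*\}$. (3) Replace $\mathcal{O}$ by $\mathcal{O}\cap\{y\in\mathbb{R}^q\mid w^{\top}y\ge w^{\top}Px\}$, recompute the set $\mathcal{O}_{\rm poi}$ of vertices of $\mathcal{O}$, and choose any $t\in\mathcal{O}_{\rm poi}$ minimizing $f$ over $\mathcal{O}_{\rm poi}$. (4) If $\min\{\varphi(t,y^* )\mid y^*\in\mathcal{O}^*_{\rm poi}\}<0$, choose any $t^*$ minimizing $\varphi(t,\cdot)$ over $\mathcal{O}^*_{\rm poi}\setminus T^*$ and continue the loop; otherwise determine some $x\in S$ with $t=Px$, stop, and return $x$. *)

theory Defs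
  imports "HOL-Analysis.Analysis"
begin

definition recession_cone :: "'a::real_vector set \<Rightarrow> 'a set" where
  "recession_cone D = {d. \<forall>y\<in>D. \<forall>r\<ge>0. y + r *\<^sub>R d \<in> D}"

definition pointed :: "'a::real_vector set \<Rightarrow> bool" where
  "pointed C \<longleftrightarrow> C \<inter> uminus ` C = {0}"

definition minkowski_sum :: "'a::plus set \<Rightarrow> 'a set \<Rightarrow> 'a set" where
  "minkowski_sum X Y = {x + y | x y. x \<in> X \<and> y \<in> Y}"

definition minkowski_diff :: "'a::minus set \<Rightarrow> 'a set \<Rightarrow> 'a set" where
  "minkowski_diff X Y = {x - y | x y. x \<in> X \<and> y \<in> Y}"

definition quasi_concave :: "('a::real_vector \<Rightarrow> ereal) \<Rightarrow> bool" where
  "quasi_concave f \<longleftrightarrow> (\<forall>r::real. convex {y. f y \<ge> ereal r})"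

definition cone_monotone_on :: "'a::real_vector set \<Rightarrow> 'a set \<Rightarrow> ('a \<Rightarrow> ereal) \<Rightarrow> bool" where
  "cone_monotone_on C D f \<longleftrightarrow> (\<forall>x\<in>D. \<forall>y\<in>D. y - x \<in> C \<longrightarrow> f x \<le> f y)"

text \<open>The order on \<^typ>\<open>real ^ 'm\<close> is the componentwise one.\<close>

definition feasible_set :: "real ^ 'n ^ 'm \<Rightarrow> real ^ 'm \<Rightarrow> (real ^ 'n) set" where
  "feasible_set A b = {x. A *v x \<ge> b}"

definition vertices :: "'a::real_vector set \<Rightarrow> 'a set" where
  "vertices D = {v. v extreme_point_of D}"

text \<open>
  In the following two definitions the index \<open>k\<close> plays the role of the last index \<open>q\<close>.
\<close>

definition omega :: "'q::finite \<Rightarrow> real ^ 'q \<Rightarrow> real ^ 'q \<Rightarrow> real ^ 'q" where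
  "omega k c ys = (\<chi> i. if i = k then 1 - (\<Sum>j\<in>UNIV - {k}. c $ j * ys $ j) else ys $ i)"

definition phi :: "'q::finite \<Rightarrow> real ^ 'q \<Rightarrow> real ^ 'q \<Rightarrow> real ^ 'q \<Rightarrow> real" where
  "phi k c y ys = (\<Sum>i\<in>UNIV - {k}. y $ i * ys $ i)
     + y $ k * (1 - (\<Sum>i\<in>UNIV - {k}. c $ i * ys $ i)) - ys $ k"

text \<open>
  The current dual point may have last component \<open>+\<infinity>\<close>, hence it is a vector of extended reals.
  The value that \<open>real_part\<close> gives to an infinite last component is irrelevant, because
  \<^const>\<open>omega\<close> does not depend on that component.
\<close>

definition extended :: "real ^ 'q \<Rightarrow> ereal ^ 'q" where
  "extended y = (\<chi> i. ereal (y $ i))"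

definition real_part :: "ereal ^ 'q \<Rightarrow> real ^ 'q" where
  "real_part y = (\<chi> i. real_of_ereal (y $ i))"

text \<open>
  The states are the control points of the algorithm: before the initialization, before each of
  the four steps of the loop, and after the return. The components are, in this order and as far as
  they are still needed, the primal outer approximation, the dual outer approximation, the set
  \<open>T\<^sup>*\<close>, the dual point \<open>t\<^sup>*\<close>, and then the weight \<open>w\<close> and the solution \<open>x\<close> of
  the linear program, or the vertex \<open>t\<close>.
\<close>

datatype ('q::finite, 'n::finite) state =
    Init "(real ^ 'q) set"
  | Solve_LP "(real ^ 'q) set" "(real ^ 'q) set" "(ereal ^ 'q) set" "ereal ^ 'q"
  | Update_Dual "(real ^ 'q) set" "(real ^ 'q) set" "(ereal ^ 'q) set" "ereal ^ 'q"
      "real ^ 'q" "real ^ 'n"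
  | Update_Primal "(real ^ 'q) set" "(real ^ 'q) set" "(ereal ^ 'q) set" "real ^ 'q" "real ^ 'n"
  | Test "(real ^ 'q) set" "(real ^ 'q) set" "(ereal ^ 'q) set" "real ^ 'q"
  | Returned "real ^ 'n"

text \<open>
  Every admissible choice is a separate transition. The premises also record what a step needs in
  order to be executable (nonzero denominator, finitely many vertices to be computed, existence of
  the minima), so a state in which the pending step cannot be carried out is a state without
  successor. The vertex sets are functions of the current outer approximations and therefore not
  stored.
\<close>

inductive alg_step ::
  "real ^ 'n ^ 'm \<Rightarrow> real ^ 'm \<Rightarrow> real ^ 'n ^ 'q \<Rightarrow> real ^ 'p ^ 'q \<Rightarrow> real ^ 'o ^ 'q
    \<Rightarrow> 'q \<Rightarrow> real ^ 'q \<Rightarrow> (real ^ 'q \<Rightarrow> ereal)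
    \<Rightarrow> ('q, 'n) state \<Rightarrow> ('q, 'n) state \<Rightarrow> bool"
  for A b P Z Y k c f where
  initialize:
    "\<lbrakk> w = (\<Sum>j\<in>UNIV. column j Z); c \<bullet> w \<noteq> 0;
       dual = {ys. \<forall>y\<in>columns Y. y \<bullet> omega k c ys \<ge> 0};
       ts = (\<chi> i. if i = k then \<infinity> else extended (inverse (c \<bullet> w) *\<^sub>R w) $ i) \<rbrakk>
     \<Longrightarrow> alg_step A b P Z Y k c f (Init outer) (Solve_LP outer dual {} ts)"
| solve_LP:
    "\<lbrakk> w = omega k c (real_part ts);
       is_arg_min (\<lambda>x. w \<bullet> (P *v x)) (\<lambda>x. x \<in> feasible_set A b) x \<rbrakk>
     \<Longrightarrow> alg_step A b P Z Y k c f (Solve_LP outer dual T ts) (Update_Dual outer dual T ts w x)"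
| cut_dual:
    "\<lbrakk> ts $ k - ereal (w \<bullet> (P *v x)) > 0;
       dual' = dual \<inter> {ys. phi k c (P *v x) ys \<ge> 0};
       finite (vertices dual') \<rbrakk>
     \<Longrightarrow> alg_step A b P Z Y k c f (Update_Dual outer dual T ts w x)
           (Update_Primal outer dual' T w x)"
| confirm_dual:
    "\<lbrakk> \<not> ts $ k - ereal (w \<bullet> (P *v x)) > 0 \<rbrakk>
     \<Longrightarrow> alg_step A b P Z Y k c f (Update_Dual outer dual T ts w x)
           (Update_Primal outer dual (T \<union> {ts}) w x)"
| cut_primal:
    "\<lbrakk> outer' = outer \<inter> {y. w \<bullet> y \<ge> w \<bullet> (P *v x)};
       finite (vertices outer');
       is_arg_min f (\<lambda>y. y \<in> vertices outer') t \<rbrakk>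
     \<Longrightarrow> alg_step A b P Z Y k c f (Update_Primal outer dual T w x) (Test outer' dual T t)"
| continue:
    "\<lbrakk> finite (vertices dual); vertices dual \<noteq> {};
       Min (phi k c t ` vertices dual) < 0;
       is_arg_min (phi k c t) (\<lambda>ys. ys \<in> vertices dual \<and> extended ys \<notin> T) ts \<rbrakk>
     \<Longrightarrow> alg_step A b P Z Y k c f (Test outer dual T t) (Solve_LP outer dual T (extended ts))"
| return:
    "\<lbrakk> finite (vertices dual); vertices dual \<noteq> {};
       \<not> Min (phi k c t ` vertices dual) < 0;
       x \<in> feasible_set A b; t = P *v x \<rbrakk>
     \<Longrightarrow> alg_step A b P Z Y k c f (Test outer dual T t) (Returned x)"

end

theory Submission
  imports Defs
begin

text \<open>
  Correctness: the outer approximation \<open>D\<close> is the convex hull of its vertices plus \<open>C\<close>, so a point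
  of \<open>P[S]\<close> dominates, by an element of \<open>C\<close>, a convex combination of vertices; monotonicity and
  quasi-concavity bound its objective value from below by the least value \<open>f t\<close> at a vertex. If
  \<open>phi t\<close> is nonnegative at the vertices of the dual approximation, it is nonnegative on the lower
  image, hence \<open>t\<close> lies in the upper image \<open>P[S] + C\<close>, and an extreme point of \<open>D\<close> that lies in
  there is in \<open>P[S]\<close>. A confirmed dual point \<open>ys\<close> satisfies \<open>phi y ys \<ge> 0\<close> for all \<open>y \<in> D\<close> because
  of the corresponding primal cut, so a violating vertex always exists outside \<open>T\<^sup>*\<close>.

  Finiteness: the solution \<open>x\<close> of the linear program need not be a vertex of \<open>S\<close>, but whether \<open>x\<close>
  minimises a linear functional over \<open>S\<close> depends only on the set of its active constraints. After a
  dual cut with \<open>x\<close>, no dual cut with a solution having the same active constraints can occur, so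
  there are finitely many dual cuts; between two of them, every iteration confirms a new vertex of
  an unchanged dual approximation.
\<close>

section \<open>Extreme points of unbounded convex sets\<close>

text \<open>Normalising an unbounded sequence in the sublevel set yields a unit vector
  \<open>d\<close> as a limit. Closedness and convexity make \<open>d\<close> a recession direction,
  while dividing \<open>w \<bullet> z \<le> M\<close> by the norms gives
  \<open>w \<bullet> d \<le> 0\<close>.\<close>

lemma bounded_sublevel_if_pos_on_recession_cone:
  fixes K :: "'a::euclidean_space set"
  assumes "closed K" "convex K"
    and pos: "\<And>d. d \<in> recession_cone K \<Longrightarrow> d \<noteq> 0 \<Longrightarrow> 0 < w \<bullet> d"
  shows "bounded {z \<in> K. w \<bullet> z \<le> M}"
proof (rule ccontr)
  let ?B = "{z \<in> K. w \<bullet> z \<le> M}"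
  assume unb: "\<not> bounded ?B"
  have "\<exists>z\<in>?B. real n < norm z" for n
    using unb unfolding bounded_iff by (metis not_le)
  then obtain z where z: "\<And>n. z n \<in> ?B" "\<And>n. real n < norm (z n)"
    by metis
  define u where "u n = z n /\<^sub>R norm (z n)" for n
  have nz: "norm (z n) > 0" for n
    using z(2)[of n] of_nat_0_le_iff[of n, where 'a=real] by linarith
  have "u n \<in> sphere 0 1" for n
    using nz[of n] by (simp add: u_def)
  then obtain d r where d: "d \<in> sphere 0 1" "strict_mono r" "(u \<circ> r) \<longlonglongrightarrow> d"
    using compact_sphere[of "0::'a" 1] unfolding compact_def by meson
  have "filterlim (\<lambda>n. norm (z n)) at_top sequentially"
    by (rule filterlim_at_top_mono[OF filterlim_real_sequentially])
      (use z(2) in \<open>auto intro!: always_eventually less_imp_le\<close>)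
  then have "(\<lambda>n. inverse (norm (z n))) \<longlonglongrightarrow> 0"
    by (rule tendsto_inverse_0_at_top)
  then have inv: "(\<lambda>n. inverse (norm (z (r n)))) \<longlonglongrightarrow> 0"
    using LIMSEQ_subseq_LIMSEQ[OF _ d(2)] by (simp add: o_def)
  have u: "(\<lambda>n. u (r n)) \<longlonglongrightarrow> d"
    using d(3) by (simp add: o_def)
  have "y + t *\<^sub>R d \<in> K" if y: "y \<in> K" and t: "0 \<le> t" for y t
  proof (rule Lim_in_closed_set[OF assms(1)])
    \<comment> \<open>Once the weight \<open>t * inverse (norm (z (r n)))\<close> is below 1, this
      is a convex combination of \<open>y\<close> and \<open>z (r n)\<close>.\<close>
    let ?s = "\<lambda>n. (1 - t * inverse (norm (z (r n)))) *\<^sub>R y + t *\<^sub>R u (r n)"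
    have "?s \<longlonglongrightarrow> (1 - t * 0) *\<^sub>R y + t *\<^sub>R d"
      by (intro tendsto_intros inv u)
    then show "?s \<longlonglongrightarrow> y + t *\<^sub>R d" by simp
    have "(\<lambda>n. t * inverse (norm (z (r n)))) \<longlonglongrightarrow> t * 0"
      by (intro tendsto_intros inv)
    then have "\<forall>\<^sub>F n in sequentially. t * inverse (norm (z (r n))) < 1"
      by (simp add: order_tendstoD(2))
    then show "\<forall>\<^sub>F n in sequentially. ?s n \<in> K"
    proof eventually_elim
      case (elim n)
      have "(1 - t * inverse (norm (z (r n)))) *\<^sub>R y + (t * inverse (norm (z (r n)))) *\<^sub>R z (r n) \<in> K"
        using z(1)[of "r n"] elim t y by (intro convexD[OF assms(2)]) auto
      then show ?case by (simp add: u_def)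
    qed
  qed simp
  then have "d \<in> recession_cone K"
    by (simp add: recession_cone_def)
  moreover have "d \<noteq> 0" using d(1) by auto
  ultimately have "0 < w \<bullet> d" by (rule pos)
  have "w \<bullet> d \<le> M * 0"
  proof (rule LIMSEQ_le)
    show "(\<lambda>n. w \<bullet> u (r n)) \<longlonglongrightarrow> w \<bullet> d" by (intro tendsto_intros u)
    show "(\<lambda>n. M * inverse (norm (z (r n)))) \<longlonglongrightarrow> M * 0" by (intro tendsto_intros inv)
    have "w \<bullet> u n \<le> M * inverse (norm (z n))" for n
      using z(1)[of n] nz[of n] by (simp add: u_def field_simps)
    then show "\<exists>N. \<forall>n\<ge>N. w \<bullet> u (r n) \<le> M * inverse (norm (z (r n)))"
      by blast
  qed
  with \<open>0 < w \<bullet> d\<close> show False by simp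
qed

text \<open>The functional attains its minimum over \<open>K\<close> on a compact face, and extreme
  points of a face are extreme in \<open>K\<close>.\<close>

lemma linear_minimum_at_extreme_point:
  fixes K :: "'a::euclidean_space set"
  assumes "closed K" "convex K" "y \<in> K" and bdd: "bounded {z \<in> K. g \<bullet> z \<le> g \<bullet> y}"
  obtains v where "v extreme_point_of K" "g \<bullet> v \<le> g \<bullet> y"
proof -
  let ?B = "{z \<in> K. g \<bullet> z \<le> g \<bullet> y}"
  have B: "?B = K \<inter> {z. g \<bullet> z \<le> g \<bullet> y}" by auto
  have "compact ?B"
    using bdd assms(1) unfolding B by (simp add: compact_eq_bounded_closed closed_Int closed_halfspace_le)
  moreover have "?B \<noteq> {}" using assms(3) by auto
  moreover have "continuous_on ?B (\<lambda>z. g \<bullet> z)" by (intro continuous_intros)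
  ultimately obtain m where m: "m \<in> ?B" "\<And>z. z \<in> ?B \<Longrightarrow> g \<bullet> m \<le> g \<bullet> z"
    using continuous_attains_inf by meson
  have ge: "g \<bullet> m \<le> g \<bullet> z" if "z \<in> K" for z
    using m that by fastforce
  let ?F = "K \<inter> {z. g \<bullet> z = g \<bullet> m}"
  have face: "?F face_of K"
    by (rule face_of_Int_supporting_hyperplane_ge[OF assms(2) ge])
  have "bounded ?F" by (rule bounded_subset[OF bdd]) (use m(1) in auto)
  then have "compact ?F"
    using assms(1) by (simp add: compact_eq_bounded_closed closed_Int closed_hyperplane)
  moreover have "convex ?F" by (rule face_of_imp_convex[OF face])
  moreover have "?F \<noteq> {}" using m(1) by auto
  ultimately obtain v where "v extreme_point_of ?F"
    by (rule extreme_point_exists_convex)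
  then have "v extreme_point_of K" "v \<in> ?F"
    using extreme_point_of_face[OF face] by auto
  then show thesis using that m(1) by auto
qed

lemma closed_conv_plus_cone:
  fixes C :: "'a::euclidean_space set"
  assumes "finite E" "closed C" "convex C"
  shows "closed (minkowski_sum (convex hull E) C)" "convex (minkowski_sum (convex hull E) C)"
proof -
  have eq: "minkowski_sum (convex hull E) C = (\<Union>x\<in>convex hull E. \<Union>y\<in>C. {x + y})"
    by (auto simp: minkowski_sum_def)
  show "closed (minkowski_sum (convex hull E) C)"
    unfolding eq by (intro compact_closed_sums finite_imp_compact_convex_hull assms)
  show "convex (minkowski_sum (convex hull E) C)"
    unfolding eq by (intro convex_sums convex_convex_hull assms)
qed

lemma nonneg_if_affine_bounded_below:
  fixes u v \<beta> :: real
  assumes "\<And>r. 0 \<le> r \<Longrightarrow> \<beta> \<le> u + r * v"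
  shows "0 \<le> v"
proof (rule ccontr)
  assume "\<not> 0 \<le> v"
  \<comment> \<open>For this \<open>r\<close> the value \<open>u + r * v\<close> is
    \<open>u - \<bar>u\<bar> - \<bar>\<beta>\<bar> - 1\<close>, which is below
    \<open>\<beta>\<close>.\<close>
  define r where "r = (\<bar>u\<bar> + \<bar>\<beta>\<bar> + 1) / - v"
  have "0 \<le> r" using \<open>\<not> 0 \<le> v\<close> unfolding r_def by (intro divide_nonneg_pos) auto
  moreover have "r * v = - (\<bar>u\<bar> + \<bar>\<beta>\<bar> + 1)"
    using \<open>\<not> 0 \<le> v\<close> by (simp add: r_def field_simps)
  ultimately show False using assms[of r] by simp
qed

text \<open>A compact set plus a closed one is closed, so strict separation applies. The functional
  is bounded below on rays from a point of \<open>E\<close> in directions of \<open>C\<close>, hence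
  nonnegative on \<open>C\<close>.\<close>

lemma separate_conv_plus_cone:
  fixes C :: "'a::euclidean_space set"
  assumes "finite E" "E \<noteq> {}" "closed C" "convex C" "0 \<in> C"
    and cone: "\<And>d r. d \<in> C \<Longrightarrow> 0 \<le> r \<Longrightarrow> r *\<^sub>R d \<in> C"
    and "y \<notin> minkowski_sum (convex hull E) C"
  obtains a \<beta> where "a \<bullet> y < \<beta>" "\<And>d. d \<in> C \<Longrightarrow> 0 \<le> a \<bullet> d"
    "\<And>z. z \<in> minkowski_sum (convex hull E) C \<Longrightarrow> \<beta> < a \<bullet> z"
proof -
  obtain a \<beta> where ab: "a \<bullet> y < \<beta>" "\<And>z. z \<in> minkowski_sum (convex hull E) C \<Longrightarrow> \<beta> < a \<bullet> z"
    using separating_hyperplane_closed_point[OF closed_conv_plus_cone(2,1)] assms by metis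
  obtain e where e: "e \<in> E" using assms(2) by auto
  have "0 \<le> a \<bullet> d" if d: "d \<in> C" for d
  proof (rule nonneg_if_affine_bounded_below)
    fix r :: real assume "0 \<le> r"
    then have "e + r *\<^sub>R d \<in> minkowski_sum (convex hull E) C"
      using e d cone by (auto simp: minkowski_sum_def intro!: hull_inc)
    then show "\<beta> \<le> a \<bullet> e + r * (a \<bullet> d)"
      using ab(2) by (force simp: inner_add_right)
  qed
  with that ab show thesis by blast
qed

text \<open>
  A point outside the sum would be separated from it by a functional that is nonnegative on the cone;
  adding a small multiple of \<open>w\<close> makes it positive, so that it attains its minimum over \<open>K\<close> at an
  extreme point, which is then on the wrong side.
\<close>

lemma subset_conv_extreme_points_plus_cone:
  fixes K C :: "'a::euclidean_space set"
  assumes K: "closed K" "convex K" and fin: "finite {v. v extreme_point_of K}"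
    and C: "closed C" "convex C" "0 \<in> C"
    and cone: "\<And>d r. d \<in> C \<Longrightarrow> 0 \<le> r \<Longrightarrow> r *\<^sub>R d \<in> C"
    and w: "\<And>d. d \<in> C \<Longrightarrow> d \<noteq> 0 \<Longrightarrow> 0 < w \<bullet> d"
    and bdd: "\<And>a M. (\<And>d. d \<in> C \<Longrightarrow> d \<noteq> 0 \<Longrightarrow> 0 < a \<bullet> d) \<Longrightarrow> bounded {z \<in> K. a \<bullet> z \<le> M}"
  shows "K \<subseteq> minkowski_sum (convex hull {v. v extreme_point_of K}) C"
proof
  fix y assume y: "y \<in> K"
  let ?E = "{v. v extreme_point_of K}"
  have E: "?E \<noteq> {}"
    using linear_minimum_at_extreme_point[OF K y bdd[OF w]] by auto
  show "y \<in> minkowski_sum (convex hull ?E) C"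
  proof (rule ccontr)
    assume "y \<notin> minkowski_sum (convex hull ?E) C"
    then obtain a \<beta> where a: "a \<bullet> y < \<beta>" "\<And>d. d \<in> C \<Longrightarrow> 0 \<le> a \<bullet> d"
      "\<And>z. z \<in> minkowski_sum (convex hull ?E) C \<Longrightarrow> \<beta> < a \<bullet> z"
      using separate_conv_plus_cone[OF fin E C cone] by blast
    \<comment> \<open>\<open>B\<close> serves all extreme points at once, since
      \<open>\<epsilon>\<close> must be fixed before the extreme point \<open>v\<close> that depends
      on it is known.\<close>
    define B where "B = 1 + (\<Sum>e\<in>?E. \<bar>w \<bullet> (y - e)\<bar>)"
    define \<epsilon> where "\<epsilon> = (\<beta> - a \<bullet> y) / B"
    have B: "0 < B" unfolding B_def by (intro add_pos_nonneg sum_nonneg) auto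
    have \<epsilon>: "0 < \<epsilon>" using a(1) B by (simp add: \<epsilon>_def)
    let ?g = "a + \<epsilon> *\<^sub>R w"
    have "0 < ?g \<bullet> d" if "d \<in> C" "d \<noteq> 0" for d
      using a(2) w \<epsilon> that by (simp add: inner_add_left add_nonneg_pos)
    then obtain v where v: "v extreme_point_of K" "?g \<bullet> v \<le> ?g \<bullet> y"
      using linear_minimum_at_extreme_point[OF K y bdd] by metis
    have "v \<in> minkowski_sum (convex hull ?E) C"
      using v(1) C(3) unfolding minkowski_sum_def
      by (intro CollectI exI[of _ v] exI[of _ 0]) (simp add: hull_inc)
    then have "\<beta> < a \<bullet> v" by (rule a(3))
    have "\<bar>w \<bullet> (y - v)\<bar> \<le> (\<Sum>e\<in>?E. \<bar>w \<bullet> (y - e)\<bar>)"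
      by (rule member_le_sum) (use fin v in auto)
    then have "w \<bullet> (y - v) \<le> B" by (simp add: B_def)
    then have "\<epsilon> * (w \<bullet> (y - v)) \<le> \<epsilon> * B" using \<epsilon> by simp
    also have "\<dots> = \<beta> - a \<bullet> y" using B by (simp add: \<epsilon>_def)
    also have "\<dots> < a \<bullet> v - a \<bullet> y" using \<open>\<beta> < a \<bullet> v\<close> by simp
    finally show False
      using v(2) by (simp add: inner_add_left inner_diff_right algebra_simps)
  qed
qed

section \<open>Polyhedra given by inequalities\<close>

lemma feasible_set_halfspaces: "feasible_set A b = (\<Inter>i\<in>UNIV. {x. b $ i \<le> A $ i \<bullet> x})"
  by (auto simp: feasible_set_def less_eq_vec_def matrix_vector_mul_component)

lemma polyhedron_feasible_set: "polyhedron (feasible_set A b)"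
  unfolding feasible_set_halfspaces
  by (intro polyhedron_Inter) (auto simp: polyhedron_halfspace_ge)

lemma polyhedron_affine_ge: "polyhedron {ys. 0 \<le> \<alpha> + g \<bullet> ys}" for \<alpha> and g :: "'e::euclidean_space"
proof -
  have "{ys. 0 \<le> \<alpha> + g \<bullet> ys} = {ys. - \<alpha> \<le> g \<bullet> ys}" by auto
  then show ?thesis using polyhedron_halfspace_ge by metis
qed

lemma scaleR_matrix_vector_mult: "(A :: real ^ 'n ^ 'm) *v (r *\<^sub>R x) = r *\<^sub>R (A *v x)"
  by (simp add: linear_scale[OF matrix_vector_mul_linear])

text \<open>Intersecting with the row space removes the lines contained in the polyhedron.\<close>

lemma feasible_set_decomposition:
  fixes A :: "real ^ 'n ^ 'm"
  assumes "feasible_set A b \<noteq> {}"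
  obtains V where "finite V" "V \<noteq> {}" "V \<subseteq> feasible_set A b"
    "\<And>x. x \<in> feasible_set A b \<Longrightarrow> \<exists>v\<in>convex hull V. 0 \<le> A *v (x - v)"
proof -
  define U where "U = span (rows A)"
  define K where "K = feasible_set A b \<inter> U"
  define D where "D = {d \<in> U. 0 \<le> A *v d}"
  define V where "V = {v. v extreme_point_of K}"
  define w where "w = (\<Sum>i\<in>UNIV. A $ i)"
  have U: "subspace U" by (simp add: U_def)
  have polyK: "polyhedron K"
    unfolding K_def
    by (intro polyhedron_Int polyhedron_feasible_set affine_imp_polyhedron subspace_imp_affine U)
  have Deq: "D = U \<inter> feasible_set A 0" by (auto simp: D_def feasible_set_def)
  have polyD: "polyhedron D"
    unfolding Deq
    by (intro polyhedron_Int polyhedron_feasible_set affine_imp_polyhedron subspace_imp_affine U)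
  \<comment> \<open>A nonzero vector of the row space is not in the null space, so some row is
    positive on it.\<close>
  have w: "0 < w \<bullet> d" if "d \<in> D" "d \<noteq> 0" for d
  proof -
    have nn: "0 \<le> A $ i \<bullet> d" for i
      using that by (auto simp: D_def less_eq_vec_def matrix_vector_mul_component)
    have "A *v d \<noteq> 0"
      using that nullspace_inter_rowspace[of A d] by (auto simp: D_def U_def)
    then obtain i where "A $ i \<bullet> d \<noteq> 0"
      by (auto simp: vec_eq_iff matrix_vector_mul_component)
    then have "0 < (\<Sum>i\<in>UNIV. A $ i \<bullet> d)"
      using nn by (intro sum_pos2[of _ i]) (auto simp: less_le)
    then show ?thesis by (simp add: w_def inner_sum_left)
  qed
  \<comment> \<open>The point \<open>z\<close> matters: under this definition the recession cone of
    the empty set is the whole space.\<close>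
  have rec: "recession_cone K \<subseteq> D" if z: "z \<in> K" for z
  proof
    fix d assume "d \<in> recession_cone K"
    then have ray: "z + r *\<^sub>R d \<in> K" if "0 \<le> r" for r
      using z that by (auto simp: recession_cone_def)
    have "d \<in> U"
      using subspace_diff[OF U, of "z + 1 *\<^sub>R d" z] ray[of 1] z by (auto simp: K_def)
    moreover have "0 \<le> (A *v d) $ i" for i
    proof (rule nonneg_if_affine_bounded_below)
      fix r :: real assume "0 \<le> r"
      then have "b $ i \<le> (A *v (z + r *\<^sub>R d)) $ i"
        using ray by (auto simp: K_def feasible_set_def less_eq_vec_def)
      then show "b $ i \<le> (A *v z) $ i + r * (A *v d) $ i"
        by (simp add: matrix_vector_right_distrib scaleR_matrix_vector_mult)
    qed
    ultimately show "d \<in> D" by (simp add: D_def less_eq_vec_def)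
  qed
  have bdd: "bounded {z \<in> K. a \<bullet> z \<le> M}" if a: "\<And>d. d \<in> D \<Longrightarrow> d \<noteq> 0 \<Longrightarrow> 0 < a \<bullet> d" for a M
  proof (cases "K = {}")
    case False
    then show ?thesis
      using bounded_sublevel_if_pos_on_recession_cone[OF polyhedron_imp_closed polyhedron_imp_convex]
        polyK rec a by blast
  qed simp
  have repr: "K \<subseteq> minkowski_sum (convex hull V) D"
    unfolding V_def
  proof (rule subset_conv_extreme_points_plus_cone[where w=w])
    show "r *\<^sub>R d \<in> D" if "d \<in> D" "0 \<le> r" for d r
      using that U by (auto simp: D_def subspace_scale scaleR_matrix_vector_mult less_eq_vec_def)
  qed (use polyK polyD w bdd U in \<open>auto simp: polyhedron_imp_closed polyhedron_imp_convex
      finite_polyhedron_extreme_points subspace_0 D_def\<close>)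
  have dec: "\<exists>v\<in>convex hull V. 0 \<le> A *v (x - v)" if x: "x \<in> feasible_set A b" for x
  proof -
    \<comment> \<open>The part \<open>z\<close> orthogonal to the row space is annihilated by
      \<open>A\<close>, so it affects neither feasibility nor the condition on
      \<open>x - v\<close>.\<close>
    obtain y z where yz: "y \<in> U" "\<And>u. u \<in> U \<Longrightarrow> orthogonal z u" "x = y + z"
      using orthogonal_subspace_decomp_exists[of "rows A" x] unfolding U_def by blast
    have "A $ i \<bullet> z = 0" for i
    proof -
      have "row i A \<in> U" unfolding U_def by (intro span_base) (auto simp: rows_def)
      then show ?thesis using yz(2) by (simp add: orthogonal_def row_def inner_commute[of "A $ i"])
    qed
    then have Az: "A *v z = 0" by (simp add: vec_eq_iff matrix_vector_mul_component)
    then have "y \<in> K"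
      using x yz(1,3) by (simp add: K_def feasible_set_def matrix_vector_right_distrib)
    then obtain v d where vd: "v \<in> convex hull V" "d \<in> D" "y = v + d"
      using repr by (auto simp: minkowski_sum_def)
    have "x - v = d + z" using vd yz by simp
    then have "A *v (x - v) = A *v d" by (simp add: matrix_vector_right_distrib Az)
    then have "0 \<le> A *v (x - v)" using vd(2) by (simp add: D_def)
    then show ?thesis using vd(1) by blast
  qed
  show thesis
  proof
    show "finite V" unfolding V_def by (rule finite_polyhedron_extreme_points[OF polyK])
    show "V \<noteq> {}" using dec assms by auto
    show "V \<subseteq> feasible_set A b" by (auto simp: V_def K_def extreme_point_of_def)
  qed (rule dec)
qed

section \<open>The parametrisation of the dual cone\<close>

definition dual_cone :: "'a::real_inner set \<Rightarrow> 'a set" where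
  "dual_cone C = {w. \<forall>y\<in>C. 0 \<le> y \<bullet> w}"

lemma inner_omega:
  "y \<bullet> omega k c ys
    = (\<Sum>i\<in>UNIV - {k}. y $ i * ys $ i) + y $ k * (1 - (\<Sum>i\<in>UNIV - {k}. c $ i * ys $ i))"
  by (simp add: inner_vec_def omega_def sum.remove[of UNIV k] cong: sum.cong_simp)

text \<open>For fixed \<open>ys\<close>, the condition \<open>phi \<ge> 0\<close> is thus a
  halfspace in \<open>y\<close> with normal \<open>omega k c ys\<close>; this links confirmed dual
  points to primal cuts.\<close>

lemma phi_eq: "phi k c y ys = y \<bullet> omega k c ys - ys $ k"
  by (simp add: phi_def inner_omega)

lemma inner_omega_affine:
  "y \<bullet> omega k c ys = y $ k + (\<chi> i. if i = k then 0 else y $ i - y $ k * c $ i) \<bullet> ys"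
  unfolding inner_omega
  by (simp add: inner_vec_def sum.remove[of UNIV k] algebra_simps sum_subtractf sum_distrib_left
      cong: sum.cong_simp)

lemma phi_affine:
  "phi k c y ys = y $ k + (\<chi> i. if i = k then - 1 else y $ i - y $ k * c $ i) \<bullet> ys"
  unfolding phi_eq inner_omega_affine
  by (simp add: inner_vec_def sum.remove[of UNIV k] cong: sum.cong_simp)

lemma c_inner_omega: "c $ k = 1 \<Longrightarrow> c \<bullet> omega k c ys = 1"
  by (simp add: inner_omega)

text \<open>\<open>omega\<close> parametrises the hyperplane \<open>c \<bullet> w = 1\<close>: the
  components other than \<open>k\<close> are free and determine the one at \<open>k\<close>.\<close>

lemma omega_eqI:
  assumes "c $ k = 1" "c \<bullet> w = 1" "\<And>i. i \<noteq> k \<Longrightarrow> ys $ i = w $ i"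
  shows "omega k c ys = w"
proof -
  have "1 - (\<Sum>i\<in>UNIV - {k}. c $ i * ys $ i) = w $ k"
    using assms by (simp add: inner_vec_def sum.remove[of UNIV k] cong: sum.cong_simp)
  then show ?thesis using assms(3) by (simp add: omega_def vec_eq_iff)
qed

lemma real_part_extended [simp]: "real_part (extended ys) = ys"
  by (simp add: real_part_def extended_def vec_eq_iff)

lemma extended_inject [simp]: "extended x = extended y \<longleftrightarrow> x = y"
  by (simp add: extended_def vec_eq_iff)

lemma extended_nth [simp]: "extended x $ i = ereal (x $ i)"
  by (simp add: extended_def)

text \<open>The point at distance \<open>e\<close> from \<open>c\<close> in direction
  \<open>- w\<close> still lies in \<open>C\<close>. Hence the normalisation
  \<open>c \<bullet> w = 1\<close> cuts a bounded base out of the dual cone.\<close>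

lemma dual_cone_bound:
  fixes C :: "'a::real_inner set"
  assumes "c \<in> interior C"
  obtains e where "0 < e" "\<And>w. w \<in> dual_cone C \<Longrightarrow> e * norm w \<le> c \<bullet> w"
proof -
  obtain e where e: "0 < e" "cball c e \<subseteq> C"
    using assms by (auto simp: mem_interior_cball)
  have "e * norm w \<le> c \<bullet> w" if w: "w \<in> dual_cone C" for w
  proof (cases "w = 0")
    case False
    have "c - (e / norm w) *\<^sub>R w \<in> cball c e"
      using e(1) False by (simp add: dist_norm)
    then have "0 \<le> (c - (e / norm w) *\<^sub>R w) \<bullet> w"
      using e(2) w unfolding dual_cone_def by blast
    also have "\<dots> = c \<bullet> w - e * norm w"
      using False by (simp add: inner_diff_left power2_norm_eq_inner[symmetric] power2_eq_square)
    finally show ?thesis by simp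
  qed simp
  with e(1) that show thesis by blast
qed

section \<open>Upper and lower image\<close>

locale vector_program =
  fixes P :: "real ^ 'n ^ 'q" and A :: "real ^ 'n ^ 'm" and b :: "real ^ 'm"
    and Z :: "real ^ 'p ^ 'q" and Y :: "real ^ 'o ^ 'q"
    and S :: "(real ^ 'n) set" and C :: "(real ^ 'q) set"
    and c :: "real ^ 'q" and k :: 'q
  assumes S: "S = feasible_set A b" "S \<noteq> {}"
    and C_Z: "C = {y. transpose Z *v y \<ge> 0}"
    and C_Y: "C = {Y *v l | l. l \<ge> 0}"
    and C_pointed: "pointed C"
    and rec: "recession_cone ((*v) P ` S) \<subseteq> C"
    and c: "c \<in> interior C" "c $ k = 1"
begin

abbreviation upper_image :: "(real ^ 'q) set" where
  "upper_image \<equiv> minkowski_sum ((*v) P ` S) C"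

text \<open>\<open>X\<close> holds the solutions used in dual cuts: \<open>X = {}\<close> gives the
  initial dual approximation, \<open>X = S\<close> the lower image.\<close>

definition dual_approx :: "(real ^ 'n) set \<Rightarrow> (real ^ 'q) set" where
  "dual_approx X = {ys. omega k c ys \<in> dual_cone C \<and> (\<forall>x\<in>X. 0 \<le> phi k c (P *v x) ys)}"

definition lp_solution :: "real ^ 'q \<Rightarrow> real ^ 'n \<Rightarrow> bool" where
  "lp_solution w = is_arg_min (\<lambda>x. w \<bullet> (P *v x)) (\<lambda>x. x \<in> S)"

lemma lp_solution_iff: "lp_solution w x \<longleftrightarrow> x \<in> S \<and> (\<forall>x'\<in>S. w \<bullet> (P *v x) \<le> w \<bullet> (P *v x'))"
  by (auto simp: lp_solution_def is_arg_min_def not_less)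

section \<open>The ordering cone and its dual\<close>

lemma C_iff: "y \<in> C \<longleftrightarrow> (\<forall>j. 0 \<le> column j Z \<bullet> y)"
  by (simp add: C_Z less_eq_vec_def matrix_vector_mul_component column_def transpose_def)

lemma C_polyhedron: "polyhedron C"
proof -
  have "C = feasible_set (transpose Z) 0" by (simp add: C_Z feasible_set_def)
  then show ?thesis using polyhedron_feasible_set by metis
qed

lemmas C_closed = polyhedron_imp_closed[OF C_polyhedron]
  and C_convex = polyhedron_imp_convex[OF C_polyhedron]

lemma C_0: "0 \<in> C" by (simp add: C_iff)

lemma C_scale: "d \<in> C \<Longrightarrow> 0 \<le> r \<Longrightarrow> r *\<^sub>R d \<in> C"
  by (simp add: C_iff)

lemma C_uminus: "d \<in> C \<Longrightarrow> - d \<in> C \<Longrightarrow> d = 0"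
  using C_pointed by (force simp: pointed_def)

text \<open>If every column vanished at \<open>d\<close>, then \<open>- d\<close> would lie in
  \<open>C\<close> too, contradicting pointedness.\<close>

lemma sum_columns_Z_pos:
  assumes "d \<in> C" "d \<noteq> 0"
  shows "0 < (\<Sum>j\<in>UNIV. column j Z) \<bullet> d"
proof -
  have nn: "0 \<le> column j Z \<bullet> d" for j using assms by (simp add: C_iff)
  obtain j where "column j Z \<bullet> d \<noteq> 0"
    using assms C_uminus[of d] by (metis C_iff inner_minus_right neg_equal_0_iff_equal order_refl)
  then have "0 < (\<Sum>j\<in>UNIV. column j Z \<bullet> d)"
    using nn by (intro sum_pos2[of _ j]) (auto simp: less_le)
  then show ?thesis by (simp add: inner_sum_left)
qed

lemma sum_columns_Z_dual_cone: "(\<Sum>j\<in>UNIV. column j Z) \<in> dual_cone C"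
  using sum_columns_Z_pos by (force simp: dual_cone_def inner_commute)

lemma dual_cone_iff_columns: "w \<in> dual_cone C \<longleftrightarrow> (\<forall>y\<in>columns Y. 0 \<le> y \<bullet> w)"
proof
  assume "w \<in> dual_cone C"
  moreover have "y \<in> C" if y: "y \<in> columns Y" for y
  proof -
    obtain j where "y = column j Y" using y by (auto simp: columns_def)
    then have "y = Y *v axis j 1" by (simp add: matrix_vector_mult_basis)
    moreover have "(0 :: real ^ 'o) \<le> axis j 1" by (simp add: less_eq_vec_def axis_def)
    ultimately show ?thesis unfolding C_Y by blast
  qed
  ultimately show "\<forall>y\<in>columns Y. 0 \<le> y \<bullet> w" by (auto simp: dual_cone_def)
next
  assume Yw: "\<forall>y\<in>columns Y. 0 \<le> y \<bullet> w"
  have "0 \<le> (Y *v l) \<bullet> w" if "0 \<le> l" for l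
  proof -
    have "(Y *v l) \<bullet> w = (\<Sum>j\<in>UNIV. l $ j * (column j Y \<bullet> w))"
      by (simp add: matrix_mult_sum inner_sum_left scalar_mult_eq_scaleR)
    also have "0 \<le> \<dots>"
      using that Yw by (intro sum_nonneg mult_nonneg_nonneg) (auto simp: columns_def less_eq_vec_def)
    finally show ?thesis .
  qed
  then show "w \<in> dual_cone C" by (auto simp: dual_cone_def C_Y)
qed

lemma c_inner_pos:
  assumes "w \<in> dual_cone C" "w \<noteq> 0"
  shows "0 < c \<bullet> w"
proof -
  obtain e where "0 < e" "e * norm w \<le> c \<bullet> w"
    using dual_cone_bound[OF c(1)] assms(1) by blast
  moreover have "0 < norm w" using assms(2) by simp
  ultimately show ?thesis by (meson less_le_trans mult_pos_pos)
qed

lemma sum_columns_Z_nonzero: "(\<Sum>j\<in>UNIV. column j Z) \<noteq> 0"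
proof
  assume 0: "(\<Sum>j\<in>UNIV. column j Z) = 0"
  have "C = {0}" using sum_columns_Z_pos C_0 unfolding 0 by auto
  then have "c = 0" using interior_subset[of C] c(1) by blast
  then show False using c(2) by simp
qed

text \<open>Such a \<open>d\<close> is a recession direction of \<open>S\<close>, so its image is
  one of \<open>P[S]\<close>, and the hypothesis on the recession cone of \<open>P[S]\<close>
  applies.\<close>

lemma image_recession: "0 \<le> A *v d \<Longrightarrow> P *v d \<in> C"
proof -
  assume d: "0 \<le> A *v d"
  have "x + r *\<^sub>R d \<in> S" if x: "x \<in> S" and r: "0 \<le> r" for x r
  proof -
    have "b \<le> A *v x" using x by (simp add: S feasible_set_def)
    moreover have "0 \<le> r *\<^sub>R (A *v d)" using d r by (simp add: less_eq_vec_def)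
    ultimately show ?thesis
      by (simp add: S feasible_set_def less_eq_vec_def matrix_vector_right_distrib scaleR_matrix_vector_mult
          add_increasing2)
  qed
  moreover have "P *v x + r *\<^sub>R (P *v d) = P *v (x + r *\<^sub>R d)" for x r
    by (simp add: matrix_vector_right_distrib scaleR_matrix_vector_mult)
  ultimately have "P *v d \<in> recession_cone ((*v) P ` S)"
    unfolding recession_cone_def by blast
  then show ?thesis using rec by auto
qed

text \<open>The unbounded part \<open>P *v (x - v)\<close> of a point of \<open>P[S]\<close> is
  absorbed by \<open>C\<close>. This makes the upper image accessible to strict separation.\<close>

lemma upper_image_decomposition:
  obtains V where "finite V" "V \<noteq> {}" "V \<subseteq> S"
    "upper_image = minkowski_sum (convex hull ((*v) P ` V)) C"
proof -
  obtain V where V: "finite V" "V \<noteq> {}" "V \<subseteq> S"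
    "\<And>x. x \<in> S \<Longrightarrow> \<exists>v\<in>convex hull V. 0 \<le> A *v (x - v)"
    using feasible_set_decomposition[of A b] S by metis
  have hull: "convex hull ((*v) P ` V) = (*v) P ` (convex hull V)"
    by (simp add: convex_hull_linear_image)
  have "convex hull V \<subseteq> S"
    using V(3) unfolding S(1) by (intro hull_minimal polyhedron_imp_convex polyhedron_feasible_set)
  then have "minkowski_sum (convex hull ((*v) P ` V)) C \<subseteq> upper_image"
    unfolding hull by (auto simp: minkowski_sum_def)
  moreover have "upper_image \<subseteq> minkowski_sum (convex hull ((*v) P ` V)) C"
  proof
    fix y assume "y \<in> upper_image"
    then obtain x d where y: "x \<in> S" "d \<in> C" "y = P *v x + d"
      by (auto simp: minkowski_sum_def)
    obtain v where v: "v \<in> convex hull V" "0 \<le> A *v (x - v)" using V(4) y(1) by blast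
    have "P *v (x - v) + d \<in> C"
      using image_recession[OF v(2)] y(2) by (simp add: C_iff inner_add_right)
    moreover have "y = P *v v + (P *v (x - v) + d)"
      using y by (simp add: matrix_vector_mult_diff_distrib)
    ultimately show "y \<in> minkowski_sum (convex hull ((*v) P ` V)) C"
      unfolding hull minkowski_sum_def using v(1) by blast
  qed
  ultimately show thesis using that V by blast
qed

section \<open>Linear programs, lower image and separation\<close>

lemma P_mem_upper_image: "x \<in> S \<Longrightarrow> P *v x \<in> upper_image"
  using C_0 unfolding minkowski_sum_def by force

text \<open>As \<open>w\<close> is nonnegative on \<open>C\<close>, its minimum over the finite set
  \<open>V\<close> bounds it from below on the whole upper image.\<close>

lemma lp_solution_exists:
  assumes w: "w \<in> dual_cone C"
  shows "\<exists>x. lp_solution w x"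
proof -
  obtain V where V: "finite V" "V \<noteq> {}" "V \<subseteq> S"
    "upper_image = minkowski_sum (convex hull ((*v) P ` V)) C"
    by (rule upper_image_decomposition)
  obtain m where m: "m \<in> V" "\<And>v. v \<in> V \<Longrightarrow> w \<bullet> (P *v m) \<le> w \<bullet> (P *v v)"
    using ex_is_arg_min_if_finite[OF V(1,2), of "\<lambda>v. w \<bullet> (P *v v)"]
    by (auto simp: is_arg_min_linorder)
  have "w \<bullet> (P *v m) \<le> w \<bullet> (P *v x)" if x: "x \<in> S" for x
  proof -
    obtain u d where ud: "u \<in> convex hull ((*v) P ` V)" "d \<in> C" "P *v x = u + d"
      using P_mem_upper_image[OF x] unfolding V(4) by (auto simp: minkowski_sum_def)
    have "convex hull ((*v) P ` V) \<subseteq> {u. w \<bullet> (P *v m) \<le> w \<bullet> u}"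
      using m by (intro hull_minimal convex_halfspace_ge) auto
    then have "w \<bullet> (P *v m) \<le> w \<bullet> u" using ud by auto
    moreover have "0 \<le> w \<bullet> d" using w ud by (auto simp: dual_cone_def inner_commute)
    ultimately show ?thesis by (simp add: ud inner_add_right)
  qed
  then show ?thesis using m V(3) by (auto simp: lp_solution_iff)
qed

text \<open>The component at \<open>k\<close> is the optimal value of the linear program, the
  largest one that \<open>dual_approx S\<close> admits for this \<open>w\<close>.\<close>

lemma lower_image_point:
  assumes w: "w \<in> dual_cone C" "c \<bullet> w = 1" and x: "lp_solution w x"
  defines "ys \<equiv> (\<chi> i. if i = k then w \<bullet> (P *v x) else w $ i)"
  shows "ys \<in> dual_approx S" "phi k c y ys = y \<bullet> w - w \<bullet> (P *v x)"
proof -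
  have om: "omega k c ys = w" by (rule omega_eqI) (use c w in \<open>auto simp: ys_def\<close>)
  show "ys \<in> dual_approx S"
    using w x by (auto simp: dual_approx_def om phi_eq lp_solution_iff inner_commute) (auto simp: ys_def)
  show "phi k c y ys = y \<bullet> w - w \<bullet> (P *v x)"
    by (simp add: phi_eq om) (simp add: ys_def)
qed

lemma normalise_dual_cone:
  assumes "w \<in> dual_cone C" "w \<noteq> 0"
  shows "inverse (c \<bullet> w) *\<^sub>R w \<in> dual_cone C" "c \<bullet> (inverse (c \<bullet> w) *\<^sub>R w) = 1"
  using assms c_inner_pos[OF assms] by (auto simp: dual_cone_def)

lemma lower_image_nonempty: "dual_approx S \<noteq> {}"
  using lower_image_point(1) normalise_dual_cone[OF sum_columns_Z_dual_cone sum_columns_Z_nonzero]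
    lp_solution_exists by blast

text \<open>A separating functional is nonnegative on \<open>C\<close>; normalised to
  \<open>c \<bullet> w = 1\<close>, it is the weight of a point of the lower image.\<close>

lemma upper_image_separation:
  assumes t: "t \<notin> upper_image"
  obtains ys where "ys \<in> dual_approx S" "phi k c t ys < 0"
proof -
  obtain V where V: "finite V" "V \<noteq> {}"
    "upper_image = minkowski_sum (convex hull ((*v) P ` V)) C"
    by (rule upper_image_decomposition)
  have "t \<notin> minkowski_sum (convex hull ((*v) P ` V)) C" using t V by simp
  then obtain a \<beta> where a: "a \<bullet> t < \<beta>" "\<And>d. d \<in> C \<Longrightarrow> 0 \<le> a \<bullet> d"
    "\<And>z. z \<in> upper_image \<Longrightarrow> \<beta> < a \<bullet> z"
    using separate_conv_plus_cone[of "(*v) P ` V" C t] V C_closed C_convex C_0 C_scale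
    by (metis finite_imageI image_is_empty)
  have aC: "a \<in> dual_cone C" using a(2) by (auto simp: dual_cone_def inner_commute)
  have "a \<noteq> 0" using a(1) a(3)[OF P_mem_upper_image] S(2) by force
  define w where "w = inverse (c \<bullet> a) *\<^sub>R a"
  have w: "w \<in> dual_cone C" "c \<bullet> w = 1"
    unfolding w_def using normalise_dual_cone[OF aC \<open>a \<noteq> 0\<close>] by auto
  obtain x where x: "lp_solution w x" using lp_solution_exists w by blast
  then have "a \<bullet> t < a \<bullet> (P *v x)"
    using a(1) a(3)[OF P_mem_upper_image, of x] by (auto simp: lp_solution_iff)
  then have "t \<bullet> w < w \<bullet> (P *v x)"
    using c_inner_pos[OF aC \<open>a \<noteq> 0\<close>] by (simp add: w_def inner_commute)
  then show thesis
    using lower_image_point[OF w x] that by (metis diff_less_0_iff_less)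
qed

section \<open>Dual outer approximations\<close>

lemma dual_approx_antimono: "X \<subseteq> X' \<Longrightarrow> dual_approx X' \<subseteq> dual_approx X"
  by (auto simp: dual_approx_def)

lemma dual_approx_insert: "dual_approx (insert x X) = dual_approx X \<inter> {ys. phi k c (P *v x) ys \<ge> 0}"
  by (auto simp: dual_approx_def)

lemma dual_approx_empty: "dual_approx {} = {ys. \<forall>y\<in>columns Y. y \<bullet> omega k c ys \<ge> 0}"
  by (auto simp: dual_approx_def dual_cone_iff_columns)

lemma dual_approx_polyhedron:
  assumes "finite X"
  shows "polyhedron (dual_approx X)"
proof -
  have fin: "finite (columns Y)"
    unfolding columns_def by (simp add: full_SetCompr_eq)
  have eq: "dual_approx X = (\<Inter>y\<in>columns Y. {ys. 0 \<le> y \<bullet> omega k c ys})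
      \<inter> (\<Inter>x\<in>X. {ys. 0 \<le> phi k c (P *v x) ys})"
    by (auto simp: dual_approx_def dual_cone_iff_columns)
  show ?thesis
    unfolding eq inner_omega_affine phi_affine
    using assms fin
    by (intro polyhedron_Int polyhedron_Inter finite_imageI) (auto simp: polyhedron_affine_ge)
qed

text \<open>The weights \<open>omega k c ys\<close> form a bounded set, which controls all
  components except the one at \<open>k\<close>. That one is bounded above by the cut with
  \<open>x\<close> and below by \<open>phi k c t ys \<le> M\<close>. Without any cut it would be
  unrestricted, and there would be no vertices.\<close>

lemma bounded_dual_sublevel:
  assumes "x \<in> X"
  shows "bounded {ys \<in> dual_approx X. phi k c t ys \<le> M}"
proof -
  obtain e where e: "0 < e" "\<And>w. w \<in> dual_cone C \<Longrightarrow> e * norm w \<le> c \<bullet> w"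
    using dual_cone_bound[OF c(1)] by blast
  define B where "B = 1 / e + norm t / e + norm (P *v x) / e + \<bar>M\<bar>"
  have B: "0 \<le> norm t / e" "0 \<le> norm (P *v x) / e" "0 \<le> 1 / e" using e by auto
  have "\<bar>ys $ i\<bar> \<le> B" if ys: "ys \<in> dual_approx X" "phi k c t ys \<le> M" for ys i
  proof -
    let ?w = "omega k c ys"
    have "e * norm ?w \<le> 1"
      using e(2)[of ?w] ys c_inner_omega[OF c(2)] by (simp add: dual_approx_def)
    then have w: "norm ?w \<le> 1 / e" using e(1) by (simp add: field_simps)
    have inner: "\<bar>y \<bullet> ?w\<bar> \<le> norm y / e" for y
      using Cauchy_Schwarz_ineq2[of y ?w] mult_left_mono[OF w norm_ge_zero[of y]] by simp
    show ?thesis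
    proof (cases "i = k")
      case True
      have "0 \<le> phi k c (P *v x) ys" using ys assms by (auto simp: dual_approx_def)
      then have "\<bar>ys $ k\<bar> \<le> B"
        using ys(2) inner[of t] inner[of "P *v x"] B unfolding phi_eq B_def by linarith
      with True show ?thesis by simp
    next
      case False
      then have "\<bar>ys $ i\<bar> \<le> norm ?w"
        using component_le_norm_cart[of ?w i] by (simp add: omega_def)
      then show ?thesis using w B unfolding B_def by linarith
    qed
  qed
  then have comp: "\<bar>ys $ i\<bar> \<le> B" if "ys \<in> {ys \<in> dual_approx X. phi k c t ys \<le> M}" for ys i
    using that by blast
  have "norm ys \<le> (\<Sum>i\<in>(UNIV :: 'q set). B)" if ys: "ys \<in> {ys \<in> dual_approx X. phi k c t ys \<le> M}" for ys
    by (rule order_trans[OF norm_le_l1_cart]) (rule sum_mono, rule comp[OF ys])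
  then show ?thesis unfolding bounded_iff by blast
qed

lemma phi_minimum_at_vertex:
  assumes "finite X" "X \<noteq> {}" "ys \<in> dual_approx X"
  obtains v where "v \<in> vertices (dual_approx X)" "phi k c t v \<le> phi k c t ys"
proof -
  define g where "g = (\<chi> i. if i = k then - 1 else t $ i - t $ k * c $ i)"
  have phi: "phi k c t z = t $ k + g \<bullet> z" for z by (simp add: phi_affine g_def)
  obtain x where x: "x \<in> X" using assms(2) by blast
  have "{z \<in> dual_approx X. g \<bullet> z \<le> g \<bullet> ys} = {z \<in> dual_approx X. phi k c t z \<le> phi k c t ys}"
    by (simp add: phi)
  then have bdd: "bounded {z \<in> dual_approx X. g \<bullet> z \<le> g \<bullet> ys}"
    by (simp only: bounded_dual_sublevel[OF x])
  have poly: "polyhedron (dual_approx X)" by (rule dual_approx_polyhedron[OF assms(1)])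
  obtain v where "v extreme_point_of dual_approx X" "g \<bullet> v \<le> g \<bullet> ys"
    by (rule linear_minimum_at_extreme_point[OF polyhedron_imp_closed[OF poly]
          polyhedron_imp_convex[OF poly] assms(3) bdd])
  then show thesis using that by (auto simp: vertices_def phi)
qed

lemma finite_vertices_dual: "finite X \<Longrightarrow> finite (vertices (dual_approx X))"
  unfolding vertices_def by (intro finite_polyhedron_extreme_points dual_approx_polyhedron)

lemma vertices_dual_nonempty:
  assumes "finite X" "X \<noteq> {}" "X \<subseteq> S"
  shows "vertices (dual_approx X) \<noteq> {}"
proof -
  obtain ys where "ys \<in> dual_approx X"
    using lower_image_nonempty dual_approx_antimono[OF assms(3)] by blast
  then show ?thesis using phi_minimum_at_vertex[OF assms(1,2)] by blast
qed

lemma mem_upper_image_if_phi_nonneg: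
  assumes "finite X" "X \<noteq> {}" "X \<subseteq> S"
    and nonneg: "\<And>v. v \<in> vertices (dual_approx X) \<Longrightarrow> 0 \<le> phi k c t v"
  shows "t \<in> upper_image"
proof (rule ccontr)
  assume "t \<notin> upper_image"
  then obtain ys where ys: "ys \<in> dual_approx S" "phi k c t ys < 0"
    by (rule upper_image_separation)
  then have "ys \<in> dual_approx X" using dual_approx_antimono[OF assms(3)] by blast
  then obtain v where "v \<in> vertices (dual_approx X)" "phi k c t v \<le> phi k c t ys"
    by (rule phi_minimum_at_vertex[OF assms(1,2)])
  then show False using nonneg[of v] ys(2) by simp
qed

section \<open>The active constraints\<close>

definition active :: "real ^ 'n \<Rightarrow> 'm set" where
  "active x = {i. (A *v x) $ i = b $ i}"

text \<open>If \<open>x'\<close> has the same active constraints as \<open>x\<close>, one can move from \<open>x\<close> away from \<open>x'\<close> within \<open>S\<close>.\<close>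

lemma lp_solution_active:
  assumes x: "lp_solution w x" and x': "x' \<in> S" and act: "active x' = active x"
  shows "lp_solution w x'"
proof -
  have xS: "x \<in> S" using x by (simp add: lp_solution_iff)
  have slack: "b $ i \<le> (A *v u) $ i" if "u \<in> S" for u i
    using that by (simp add: S feasible_set_def less_eq_vec_def)
  \<comment> \<open>Constraints active at both points are constant along \<open>x - x'\<close>.
    \<open>D\<close> bounds the change of the others and \<open>E\<close> is their least slack at
    \<open>x\<close>, so a step of length \<open>E / D\<close> stays feasible; the inserted 1 covers
    the case that all constraints are active.\<close>
  define D where "D = 1 + (\<Sum>i\<in>UNIV. \<bar>(A *v (x - x')) $ i\<bar>)"
  define E where "E = Min (insert 1 ((\<lambda>i. (A *v x) $ i - b $ i) ` (- active x)))"
  define \<epsilon> where "\<epsilon> = E / D"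
  have D: "0 < D" unfolding D_def by (intro add_pos_nonneg sum_nonneg) auto
  have "0 < E"
    unfolding E_def using slack[OF xS] by (subst Min_gr_iff) (auto simp: active_def less_le)
  then have \<epsilon>: "0 < \<epsilon>" using D by (simp add: \<epsilon>_def)
  have "b $ i \<le> (A *v (x + \<epsilon> *\<^sub>R (x - x'))) $ i" for i
  proof (cases "i \<in> active x")
    case True
    then have "i \<in> active x'" by (simp add: act)
    with True show ?thesis
      by (simp add: active_def matrix_vector_right_distrib scaleR_matrix_vector_mult
          matrix_vector_mult_diff_distrib)
  next
    case False
    have "\<bar>(A *v (x - x')) $ i\<bar> \<le> (\<Sum>i\<in>UNIV. \<bar>(A *v (x - x')) $ i\<bar>)"
      by (rule member_le_sum) auto
    then have "- (A *v (x - x')) $ i \<le> D" by (simp add: D_def)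
    then have "\<epsilon> * - (A *v (x - x')) $ i \<le> \<epsilon> * D" using \<epsilon> by (intro mult_left_mono) auto
    also have "\<dots> = E" using D by (simp add: \<epsilon>_def)
    also have "\<dots> \<le> (A *v x) $ i - b $ i" unfolding E_def by (rule Min_le) (use False in auto)
    finally show ?thesis
      by (simp add: matrix_vector_right_distrib scaleR_matrix_vector_mult)
  qed
  then have "x + \<epsilon> *\<^sub>R (x - x') \<in> S" by (simp add: S feasible_set_def less_eq_vec_def)
  then have "w \<bullet> (P *v x) \<le> w \<bullet> (P *v (x + \<epsilon> *\<^sub>R (x - x')))"
    using x by (simp add: lp_solution_iff)
  then have "0 \<le> \<epsilon> * (w \<bullet> (P *v x) - w \<bullet> (P *v x'))"
    by (simp add: matrix_vector_right_distrib scaleR_matrix_vector_mult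
        matrix_vector_mult_diff_distrib inner_add_right inner_diff_right)
  then have "w \<bullet> (P *v x') \<le> w \<bullet> (P *v x)"
    using \<epsilon> by (simp add: zero_le_mult_iff)
  then show ?thesis using x x' by (auto simp: lp_solution_iff intro: order_trans)
qed

end

section \<open>Primal outer approximations\<close>

text \<open>Convexity is assumed for real levels only; a real level strictly between
  \<open>f y\<close> and \<open>m\<close> also handles infinite values.\<close>

lemma quasi_concave_convex_hull:
  assumes "quasi_concave f" "\<And>v. v \<in> E \<Longrightarrow> m \<le> f v" "y \<in> convex hull E"
  shows "m \<le> f y"
proof (rule ccontr)
  assume "\<not> m \<le> f y"
  then obtain r where r: "f y < ereal r" "ereal r < m"
    using ereal_dense2[of "f y" m] by (auto simp: not_le)
  have "convex {y. ereal r \<le> f y}" using assms(1) by (simp add: quasi_concave_def)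
  moreover have "E \<subseteq> {y. ereal r \<le> f y}"
    using assms(2) r(2) by (force intro: less_imp_le less_le_trans)
  ultimately have "convex hull E \<subseteq> {y. ereal r \<le> f y}" by (rule hull_minimal[rotated])
  then show False using assms(3) r(1) by auto
qed

lemma vertices_subset: "vertices D \<subseteq> D"
  by (auto simp: vertices_def extreme_point_of_def)

locale benson_input = vector_program P A b Z Y S C c k
  for P :: "real ^ 'n ^ 'q" and A :: "real ^ 'n ^ 'm" and b :: "real ^ 'm"
    and Z :: "real ^ 'p ^ 'q" and Y :: "real ^ 'o ^ 'q"
    and S :: "(real ^ 'n) set" and C :: "(real ^ 'q) set"
    and c :: "real ^ 'q" and k :: 'q +
  fixes f :: "real ^ 'q \<Rightarrow> ereal" and outer :: "(real ^ 'q) set"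
  assumes f_qc: "quasi_concave f"
    and f_mono: "cone_monotone_on C (minkowski_diff ((*v) P ` S) C) f"
    and outer: "polyhedron outer" "upper_image \<subseteq> outer" "recession_cone outer = C"
begin

text \<open>Containment in \<open>outer\<close> replaces a condition on the recession cone of
  \<open>D\<close>: bounded sublevel sets are inherited from \<open>outer\<close>.\<close>

definition outer_ok :: "(real ^ 'q) set \<Rightarrow> bool" where
  "outer_ok D \<longleftrightarrow> polyhedron D \<and> upper_image \<subseteq> D \<and> D \<subseteq> outer"

lemma outer_representation:
  assumes "outer_ok D"
  shows "D \<subseteq> minkowski_sum (convex hull vertices D) C"
  unfolding vertices_def
proof (rule subset_conv_extreme_points_plus_cone[where w="\<Sum>j\<in>UNIV. column j Z"])
  show "bounded {z \<in> D. a \<bullet> z \<le> M}" if a: "\<And>d. d \<in> C \<Longrightarrow> d \<noteq> 0 \<Longrightarrow> 0 < a \<bullet> d" for a M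
  proof (rule bounded_subset)
    show "bounded {z \<in> outer. a \<bullet> z \<le> M}"
      using outer a
      by (intro bounded_sublevel_if_pos_on_recession_cone polyhedron_imp_closed polyhedron_imp_convex) auto
  qed (use assms in \<open>auto simp: outer_ok_def\<close>)
qed (use assms C_closed C_convex C_0 C_scale sum_columns_Z_pos in \<open>auto simp: outer_ok_def
    polyhedron_imp_closed polyhedron_imp_convex finite_polyhedron_extreme_points\<close>)

lemma finite_outer_vertices: "outer_ok D \<Longrightarrow> finite (vertices D)"
  unfolding vertices_def outer_ok_def by (intro finite_polyhedron_extreme_points) simp

lemma outer_vertices_nonempty:
  assumes D: "outer_ok D"
  shows "vertices D \<noteq> {}"
proof
  assume empty: "vertices D = {}"
  obtain x where "x \<in> S" using S(2) by blast
  then have "P *v x \<in> D" using P_mem_upper_image D by (auto simp: outer_ok_def)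
  then show False using outer_representation[OF D] by (auto simp: empty minkowski_sum_def)
qed

lemma min_vertex_le_objective:
  assumes D: "outer_ok D" and t: "is_arg_min f (\<lambda>y. y \<in> vertices D) t" and x: "x \<in> S"
  shows "f t \<le> f (P *v x)"
proof -
  have "P *v x \<in> D" using P_mem_upper_image[OF x] D by (auto simp: outer_ok_def)
  then obtain u d where ud: "u \<in> convex hull vertices D" "d \<in> C" "P *v x = u + d"
    using outer_representation[OF D] by (auto simp: minkowski_sum_def)
  have "f t \<le> f u"
    by (rule quasi_concave_convex_hull[OF f_qc _ ud(1)]) (use t in \<open>auto simp: is_arg_min_linorder\<close>)
  also have "f u \<le> f (P *v x)"
  proof -
    \<comment> \<open>Both points must be placed in \<open>P[S] - C\<close>, where \<open>f\<close>
      is monotone.\<close>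
    have "u = P *v x - d" "P *v x = P *v x - 0" "P *v x - u = d" using ud(3) by auto
    then have "u \<in> minkowski_diff ((*v) P ` S) C" "P *v x \<in> minkowski_diff ((*v) P ` S) C"
      using x ud(2) C_0 unfolding minkowski_diff_def by blast+
    moreover have "P *v x - u \<in> C" using ud(2,3) by simp
    ultimately show ?thesis using f_mono unfolding cone_monotone_on_def by blast
  qed
  finally show ?thesis .
qed

text \<open>If \<open>t = P *v x + d\<close>, then \<open>t\<close> is the midpoint of
  \<open>P *v x\<close> and \<open>P *v x + 2 *\<^sub>R d\<close>, both in \<open>D\<close>;
  extremality forces \<open>d = 0\<close>.\<close>

lemma vertex_in_image:
  assumes D: "outer_ok D" and t: "t \<in> vertices D" "t \<in> upper_image"
  shows "\<exists>x\<in>S. t = P *v x"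
proof -
  obtain x d where xd: "x \<in> S" "d \<in> C" "t = P *v x + d"
    using t(2) by (auto simp: minkowski_sum_def)
  have "2 *\<^sub>R d \<in> C" using xd(2) by (simp add: C_scale)
  then have "P *v x + 2 *\<^sub>R d \<in> upper_image"
    using xd(1) unfolding minkowski_sum_def by blast
  then have in_D: "P *v x \<in> D" "P *v x + 2 *\<^sub>R d \<in> D"
    using D P_mem_upper_image[OF xd(1)] by (auto simp: outer_ok_def)
  have "d = 0"
  proof (rule ccontr)
    assume "d \<noteq> 0"
    have "t = midpoint (P *v x) (P *v x + 2 *\<^sub>R d)"
      by (simp add: xd(3) midpoint_def vec_eq_iff field_simps)
    then have "t \<in> open_segment (P *v x) (P *v x + 2 *\<^sub>R d)"
      using \<open>d \<noteq> 0\<close> by simp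
    then show False using t(1) in_D unfolding vertices_def extreme_point_of_def by blast
  qed
  then show ?thesis using xd by auto
qed

section \<open>Invariant and termination measure\<close>

text \<open>Requiring at least one cut guarantees that vertices exist.\<close>

definition dual_ok :: "(real ^ 'q) set \<Rightarrow> bool" where
  "dual_ok E \<longleftrightarrow> (\<exists>X. finite X \<and> X \<noteq> {} \<and> X \<subseteq> S \<and> E = dual_approx X)"

definition confirmed :: "(ereal ^ 'q) set \<Rightarrow> (real ^ 'q) set \<Rightarrow> bool" where
  "confirmed T D \<longleftrightarrow> (\<forall>ts\<in>T. \<exists>ys. ts = extended ys \<and> (\<forall>y\<in>D. 0 \<le> phi k c y ys))"

text \<open>The first alternative describes the first iteration, the second all later ones.\<close>

definition loop_ok :: "(real ^ 'q) set \<Rightarrow> (ereal ^ 'q) set \<Rightarrow> ereal ^ 'q \<Rightarrow> bool" where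
  "loop_ok E T ts \<longleftrightarrow> omega k c (real_part ts) \<in> dual_cone C \<and>
    (ts $ k = \<infinity> \<and> E = dual_approx {} \<or>
     (\<exists>ys. ts = extended ys \<and> dual_ok E \<and> ys \<in> vertices E \<and> ts \<notin> T))"

text \<open>Before the primal update, \<open>confirmed\<close> refers to the set after the pending
  cut, because that cut is what justifies a point just added to \<open>T\<close>.\<close>

fun invar :: "('q, 'n) state \<Rightarrow> bool" where
  "invar (Init D) \<longleftrightarrow> D = outer"
| "invar (Solve_LP D E T ts) \<longleftrightarrow> outer_ok D \<and> confirmed T D \<and> loop_ok E T ts"
| "invar (Update_Dual D E T ts w x) \<longleftrightarrow> outer_ok D \<and> confirmed T D \<and> loop_ok E T ts
      \<and> w = omega k c (real_part ts) \<and> lp_solution w x"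
| "invar (Update_Primal D E T w x) \<longleftrightarrow> outer_ok D \<and> dual_ok E
      \<and> confirmed T (D \<inter> {y. w \<bullet> y \<ge> w \<bullet> (P *v x)}) \<and> w \<in> dual_cone C \<and> lp_solution w x"
| "invar (Test D E T t) \<longleftrightarrow> outer_ok D \<and> dual_ok E \<and> confirmed T D
      \<and> is_arg_min f (\<lambda>y. y \<in> vertices D) t"
| "invar (Returned x) \<longleftrightarrow> is_arg_min (\<lambda>x. f (P *v x)) (\<lambda>x. x \<in> S) x"

abbreviation step :: "('q, 'n) state \<Rightarrow> ('q, 'n) state \<Rightarrow> bool" where
  "step \<equiv> alg_step A b P Z Y k c f"

section \<open>Preservation of the invariant and executability of the steps\<close>

lemma lp_solution_feasible: "is_arg_min (\<lambda>x. w \<bullet> (P *v x)) (\<lambda>x. x \<in> feasible_set A b) = lp_solution w"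
  by (simp add: lp_solution_def S(1)[symmetric])

lemma c_inner_sum_columns_Z: "c \<bullet> (\<Sum>j\<in>UNIV. column j Z) \<noteq> 0"
  using c_inner_pos[OF sum_columns_Z_dual_cone sum_columns_Z_nonzero] by simp

lemma loop_ok_initial:
  assumes "w = (\<Sum>j\<in>UNIV. column j Z)"
    and "ts = (\<chi> i. if i = k then \<infinity> else extended (inverse (c \<bullet> w) *\<^sub>R w) $ i)"
  shows "loop_ok (dual_approx {}) T ts"
proof -
  have "omega k c (real_part ts) = inverse (c \<bullet> w) *\<^sub>R w"
    using normalise_dual_cone(2)[OF sum_columns_Z_dual_cone sum_columns_Z_nonzero]
    by (intro omega_eqI c) (auto simp: assms real_part_def)
  then show ?thesis
    using normalise_dual_cone(1)[OF sum_columns_Z_dual_cone sum_columns_Z_nonzero]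
    by (simp add: loop_ok_def assms)
qed

lemma outer_ok_cut:
  assumes "outer_ok D" "w \<in> dual_cone C" "lp_solution w x"
  shows "outer_ok (D \<inter> {y. w \<bullet> y \<ge> w \<bullet> (P *v x)})"
proof -
  have "w \<bullet> (P *v x) \<le> w \<bullet> y" if y: "y \<in> upper_image" for y
  proof -
    obtain x' d where "x' \<in> S" "d \<in> C" "y = P *v x' + d"
      using y by (auto simp: minkowski_sum_def)
    moreover from this have "w \<bullet> (P *v x) \<le> w \<bullet> (P *v x')" "0 \<le> w \<bullet> d"
      using assms by (auto simp: lp_solution_iff dual_cone_def inner_commute)
    ultimately show ?thesis by (simp add: inner_add_right)
  qed
  then show ?thesis
    using assms(1) by (auto simp: outer_ok_def intro!: polyhedron_Int polyhedron_halfspace_ge)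
qed

lemma invar_step:
  assumes "step s s'" "invar s"
  shows "invar s'"
  using assms
proof cases
  case (initialize w dual ts D)
  then show ?thesis
    using assms(2) outer loop_ok_initial by (auto simp: dual_approx_empty outer_ok_def confirmed_def)
next
  case (solve_LP w ts x D E T)
  then show ?thesis using assms(2) by (simp add: lp_solution_feasible)
next
  case (cut_dual ts w x E' E D T)
  have inv: "outer_ok D" "confirmed T D" "loop_ok E T ts" "w = omega k c (real_part ts)" "lp_solution w x"
    using assms(2) cut_dual by auto
  then obtain X where X: "finite X" "X \<subseteq> S" "E = dual_approx X"
    by (auto simp: loop_ok_def dual_ok_def)
  have "x \<in> S" using inv by (simp add: lp_solution_iff)
  then have "dual_ok E'"
    unfolding dual_ok_def cut_dual X
    using X by (intro exI[of _ "insert x X"]) (simp add: dual_approx_insert)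
  moreover have "w \<in> dual_cone C" using inv by (simp add: loop_ok_def)
  ultimately show ?thesis using inv cut_dual by (auto simp: confirmed_def)
next
  case (confirm_dual ts w x D E T)
  have inv: "outer_ok D" "confirmed T D" "loop_ok E T ts" "w = omega k c (real_part ts)" "lp_solution w x"
    using assms(2) confirm_dual by auto
  \<comment> \<open>An infinite last component always passes the test for a dual cut, so the first
    iteration is excluded here.\<close>
  then obtain ys where ys: "ts = extended ys" "dual_ok E"
    using confirm_dual by (auto simp: loop_ok_def)
  \<comment> \<open>The failed test says that \<open>ys $ k\<close> is at most
    \<open>w \<bullet> (P *v x)\<close>.\<close>
  have "0 \<le> phi k c y ys" if "w \<bullet> (P *v x) \<le> w \<bullet> y" for y
    using that inv(4) ys confirm_dual(3) by (simp add: phi_eq inner_commute)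
  then have "confirmed (T \<union> {ts}) (D \<inter> {y. w \<bullet> y \<ge> w \<bullet> (P *v x)})"
    using inv(2) ys by (auto simp: confirmed_def)
  then show ?thesis using inv ys confirm_dual by (simp add: loop_ok_def)
next
  case (cut_primal D' D w x t E T)
  then show ?thesis using assms(2) outer_ok_cut by simp
next
  case (continue E t T ys D)
  have inv: "outer_ok D" "dual_ok E" "confirmed T D" using assms(2) continue by auto
  have ys: "ys \<in> vertices E" "extended ys \<notin> T" using continue by (auto simp: is_arg_min_def)
  then have "ys \<in> E" using vertices_subset by blast
  then have "omega k c ys \<in> dual_cone C" using inv(2) by (auto simp: dual_ok_def dual_approx_def)
  then show ?thesis using inv ys continue by (auto simp: loop_ok_def)
next
  case (return E t x D T)
  then have "f (P *v x) \<le> f (P *v x')" if "x' \<in> S" for x'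
    using assms(2) min_vertex_le_objective that by auto
  moreover have "x \<in> S" using return by (simp add: S(1))
  ultimately show ?thesis using return by (simp add: is_arg_min_linorder)
qed

lemma dual_ok_finite: "dual_ok E \<Longrightarrow> finite (vertices E)"
  by (auto simp: dual_ok_def finite_vertices_dual)

lemma dual_ok_nonempty: "dual_ok E \<Longrightarrow> vertices E \<noteq> {}"
  using vertices_dual_nonempty by (auto simp: dual_ok_def)

lemma progress:
  assumes inv: "invar s"
  shows "(\<exists>x. s = Returned x) \<or> (\<exists>s'. step s s')"
proof (cases s)
  case (Init D)
  then show ?thesis using alg_step.initialize c_inner_sum_columns_Z by blast
next
  case (Solve_LP D E T ts)
  then have "omega k c (real_part ts) \<in> dual_cone C" using inv by (simp add: loop_ok_def)
  then obtain x where "lp_solution (omega k c (real_part ts)) x" using lp_solution_exists by blast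
  then show ?thesis
    unfolding Solve_LP lp_solution_feasible[symmetric] using alg_step.solve_LP by blast
next
  case (Update_Dual D E T ts w x)
  show ?thesis
  proof (cases "ts $ k - ereal (w \<bullet> (P *v x)) > 0")
    case True
    obtain X where "finite X" "E = dual_approx X"
      using inv Update_Dual by (auto simp: loop_ok_def dual_ok_def)
    then have "finite (vertices (E \<inter> {ys. phi k c (P *v x) ys \<ge> 0}))"
      using finite_vertices_dual[of "insert x X"] by (simp add: dual_approx_insert)
    then show ?thesis unfolding Update_Dual using alg_step.cut_dual[OF True refl] by blast
  next
    case False
    then show ?thesis unfolding Update_Dual using alg_step.confirm_dual by blast
  qed
next
  case (Update_Primal D E T w x)
  let ?D = "D \<inter> {y. w \<bullet> y \<ge> w \<bullet> (P *v x)}"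
  have D: "outer_ok ?D" using inv Update_Primal by (simp add: outer_ok_cut)
  obtain t where "is_arg_min f (\<lambda>y. y \<in> vertices ?D) t"
    using ex_is_arg_min_if_finite[OF finite_outer_vertices[OF D] outer_vertices_nonempty[OF D]] by blast
  then show ?thesis
    unfolding Update_Primal using alg_step.cut_primal[OF refl finite_outer_vertices[OF D]] by blast
next
  case (Test D E T t)
  have D: "outer_ok D" "confirmed T D" "dual_ok E" and t: "t \<in> vertices D"
    using inv Test by (auto simp: is_arg_min_def)
  note E = dual_ok_finite[OF D(3)] dual_ok_nonempty[OF D(3)]
  show ?thesis
  proof (cases "Min (phi k c t ` vertices E) < 0")
    case True
    then obtain v where v: "v \<in> vertices E" "phi k c t v < 0"
      using E by (auto simp: Min_less_iff)
    have "extended v \<notin> T"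
    proof
      assume "extended v \<in> T"
      then obtain ys where "extended v = extended ys" "\<forall>y\<in>D. 0 \<le> phi k c y ys"
        using D(2) unfolding confirmed_def by blast
      moreover have "t \<in> D" using t vertices_subset by blast
      ultimately show False using v(2) by force
    qed
    then have "{ys. ys \<in> vertices E \<and> extended ys \<notin> T} \<noteq> {}" using v by auto
    moreover have "finite {ys. ys \<in> vertices E \<and> extended ys \<notin> T}" using E by simp
    ultimately obtain ys where "is_arg_min (phi k c t) (\<lambda>ys. ys \<in> vertices E \<and> extended ys \<notin> T) ys"
      using ex_is_arg_min_if_finite[of "{ys. ys \<in> vertices E \<and> extended ys \<notin> T}" "phi k c t"] by auto
    then show ?thesis unfolding Test using alg_step.continue[OF E True] by blast
  next
    case False
    then have "0 \<le> phi k c t v" if "v \<in> vertices E" for v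
      using E that by (auto simp: Min_less_iff not_less)
    then have "t \<in> upper_image"
      using D(3) mem_upper_image_if_phi_nonneg by (auto simp: dual_ok_def)
    then obtain x where "x \<in> S" "t = P *v x"
      using vertex_in_image[OF D(1) t] by blast
    then show ?thesis
      unfolding Test S(1) using alg_step.return[OF E False] by blast
  qed
qed simp

section \<open>The termination measure\<close>

definition cuttable :: "(real ^ 'q) set \<Rightarrow> 'm set set" where
  "cuttable E = active ` {x \<in> S. \<exists>ys\<in>E. lp_solution (omega k c ys) x \<and> phi k c (P *v x) ys < 0}"

definition unconfirmed :: "(real ^ 'q) set \<Rightarrow> (ereal ^ 'q) set \<Rightarrow> (real ^ 'q) set" where
  "unconfirmed E T = {ys \<in> vertices E. extended ys \<notin> T}"

text \<open>The active set of \<open>x\<close> itself disappears. Counting active sets keeps the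
  measure finite, as they are subsets of the finite index type of the constraints.\<close>

lemma cuttable_cut:
  assumes "ys \<in> E" "lp_solution (omega k c ys) x" "phi k c (P *v x) ys < 0"
  shows "cuttable (E \<inter> {ys. phi k c (P *v x) ys \<ge> 0}) \<subset> cuttable E"
proof
  show "cuttable (E \<inter> {ys. phi k c (P *v x) ys \<ge> 0}) \<subseteq> cuttable E"
    unfolding cuttable_def by blast
  have x: "x \<in> S" using assms(2) by (simp add: lp_solution_iff)
  then have "active x \<in> cuttable E" using assms unfolding cuttable_def by blast
  moreover have "active x \<notin> cuttable (E \<inter> {ys. phi k c (P *v x) ys \<ge> 0})"
  proof
    assume "active x \<in> cuttable (E \<inter> {ys. phi k c (P *v x) ys \<ge> 0})"
    then obtain x' zs where *: "active x = active x'" "lp_solution (omega k c zs) x'"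
      "phi k c (P *v x') zs < 0" "0 \<le> phi k c (P *v x) zs" "x' \<in> S"
      unfolding cuttable_def by blast
    \<comment> \<open>So \<open>x\<close> is as good as \<open>x'\<close> for the weight of
      \<open>zs\<close>, and the cut already made with \<open>x\<close> gives
      \<open>phi k c (P *v x') zs \<ge> 0\<close>.\<close>
    have "lp_solution (omega k c zs) x" by (rule lp_solution_active[OF *(2) x *(1)])
    then show False using *(3-5) by (auto simp: lp_solution_iff phi_eq inner_commute)
  qed
  ultimately show "cuttable (E \<inter> {ys. phi k c (P *v x) ys \<ge> 0}) \<noteq> cuttable E" by blast
qed

text \<open>The first entry separates initialization and first iteration from the rest. A later dual
  cut lowers the second entry and may raise the third; a confirmation lowers the third. The last
  entry orders the control points from one primal update to the next.\<close>

fun progress_measure :: "('q, 'n) state \<Rightarrow> nat \<times> nat \<times> nat \<times> nat" where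
  "progress_measure (Init D) = (2, 0, 0, 0)"
| "progress_measure (Solve_LP D E T ts)
    = (of_bool (ts $ k = \<infinity>), card (cuttable E), card (unconfirmed E T), 2)"
| "progress_measure (Update_Dual D E T ts w x)
    = (of_bool (ts $ k = \<infinity>), card (cuttable E), card (unconfirmed E T), 1)"
| "progress_measure (Update_Primal D E T w x) = (0, card (cuttable E), card (unconfirmed E T), 4)"
| "progress_measure (Test D E T t) = (0, card (cuttable E), card (unconfirmed E T), 3)"
| "progress_measure (Returned x) = (0, 0, 0, 0)"

lemma progress_measure_step:
  assumes "step s s'" "invar s"
  shows "(progress_measure s', progress_measure s)
    \<in> less_than <*lex*> less_than <*lex*> less_than <*lex*> less_than"
  using assms
proof cases
  case (cut_dual ts w x E' E D T)
  show ?thesis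
  proof (cases "ts $ k = \<infinity>")
    case False
    then obtain ys where ys: "ts = extended ys" "ys \<in> vertices E" "w = omega k c ys" "lp_solution w x"
      using assms(2) cut_dual by (auto simp: loop_ok_def)
    have "ys \<in> E" using ys(2) vertices_subset by blast
    moreover have "phi k c (P *v x) ys < 0"
      using cut_dual(3) ys by (simp add: phi_eq inner_commute)
    ultimately have "cuttable E' \<subset> cuttable E"
      using cuttable_cut ys cut_dual by metis
    then have "card (cuttable E') < card (cuttable E)" by (simp add: psubset_card_mono)
    then show ?thesis by (simp add: cut_dual ys)
  qed (simp add: cut_dual)
next
  case (confirm_dual ts w x D E T)
  \<comment> \<open>The point is finite, as a dual cut was refused, and it was chosen outside
    \<open>T\<close>, so confirming it is real progress.\<close>
  then obtain ys where ys: "ts = extended ys" "ys \<in> vertices E" "ts \<notin> T" "dual_ok E"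
    using assms(2) by (auto simp: loop_ok_def)
  then have "unconfirmed E (T \<union> {ts}) \<subset> unconfirmed E T"
    unfolding unconfirmed_def by blast
  moreover have "finite (unconfirmed E T)"
    using dual_ok_finite[OF ys(4)] by (simp add: unconfirmed_def)
  ultimately have "card (unconfirmed E (T \<union> {ts})) < card (unconfirmed E T)"
    by (rule psubset_card_mono[rotated])
  then show ?thesis by (simp add: confirm_dual ys)
qed auto

lemma reachable_invar: "step\<^sup>*\<^sup>* (Init outer) s \<Longrightarrow> invar s"
  by (induction rule: rtranclp_induct) (auto intro: invar_step)

lemma no_infinite_run: "\<not> (\<exists>run. run 0 = Init outer \<and> (\<forall>i::nat. step (run i) (run (Suc i))))"
proof
  assume "\<exists>run. run 0 = Init outer \<and> (\<forall>i::nat. step (run i) (run (Suc i)))"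
  then obtain run where run: "run 0 = Init outer" "\<And>i::nat. step (run i) (run (Suc i))"
    by blast
  have inv: "invar (run i)" for i
    by (induction i) (use run invar_step in auto)
  let ?r = "less_than <*lex*> less_than <*lex*> less_than <*lex*> less_than"
  have "wf ?r" by (intro wf_lex_prod wf_less_than)
  moreover have "\<exists>g. \<forall>i. (g (Suc i), g i) \<in> ?r"
    using progress_measure_step[OF run(2) inv]
    by (intro exI[of _ "\<lambda>i. progress_measure (run i)"] allI)
  ultimately show False
    unfolding wf_iff_no_infinite_down_chain by (rule notE)
qed

end

theorem theorem16:
  fixes P :: "real ^ 'n ^ 'q" and A :: "real ^ 'n ^ 'm" and b :: "real ^ 'm"
    and Z :: "real ^ 'p ^ 'q" and Y :: "real ^ 'o ^ 'q"
    and S :: "(real ^ 'n) set" and C :: "(real ^ 'q) set"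
    and f :: "real ^ 'q \<Rightarrow> ereal" and c :: "real ^ 'q" and k :: 'q
    and outer :: "(real ^ 'q) set"
  assumes S: "S = feasible_set A b" "S \<noteq> {}"
    and f_qc: "quasi_concave f"
    and C_Z: "C = {y. transpose Z *v y \<ge> 0}"
    and C_Y: "C = {Y *v l | l. l \<ge> 0}"
    and C_pointed: "pointed C"
    and C_int: "interior C \<noteq> {}"
    and f_mono: "cone_monotone_on C (minkowski_diff ((*v) P ` S) C) f"
    and rec: "recession_cone ((*v) P ` S) \<subseteq> C"
    and c: "c \<in> interior C" "c $ k = 1"
    and outer: "polyhedron outer" "minkowski_sum ((*v) P ` S) C \<subseteq> outer"
      "recession_cone outer = C"
  shows
    "(\<forall>s. (alg_step A b P Z Y k c f)\<^sup>*\<^sup>* (Init outer) s \<longrightarrow>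
        (\<exists>x. s = Returned x) \<or> (\<exists>s'. alg_step A b P Z Y k c f s s')) \<and>
     \<not> (\<exists>run. run 0 = Init outer \<and> (\<forall>i::nat. alg_step A b P Z Y k c f (run i) (run (Suc i)))) \<and>
     (\<forall>x. (alg_step A b P Z Y k c f)\<^sup>*\<^sup>* (Init outer) (Returned x) \<longrightarrow>
        is_arg_min (\<lambda>x. f (P *v x)) (\<lambda>x. x \<in> S) x)"
proof -
  interpret benson_input P A b Z Y S C c k f outer
    by unfold_locales (fact assms)+
  show ?thesis
    using progress no_infinite_run reachable_invar by force
qed

end
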